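(* Let $f:\mathbb R^n\to\mathbb R$ satisfy assumption A3 of the context and let $\{y^k\}$ be generated by Algorithm DINASC (see context). Then $\lim_{k\to\infty}y^k=y^*$, where $y^*$ is the unique minimizer of $f$, and the rate of convergence is governed by the forcing sequence $\{\eta_k\}$ as follows: (a) if $\{\eta_k\}$ is a nonincreasing sequence such that $\eta_k\le\bar\eta$ for all $k$, with $\bar\eta>0$ small enough (i.e. smaller than some positive threshold determined by the problem), then $\{y^k\}$ converges linearly to $y^*$; (b) if $\eta_k\le\eta\|\nabla f(y^k)\|^\delta$ for some $\eta\ge0$ and all $k$ large enough, then the convergence is superlinear for $\delta\in(0,1)$ and quadratic for $\delta=1$.
   Context: A3 (case of a single node, $N=1$): $f:\mathbb R^n\to\mathbb R$ is twice continuously differentiable and strongly convex, and there are constants $0<\mu<M$, $L>0$ such that for all $y,z\in\mathbb R^n$: $\mu I\prec\nabla^2f(y)\prec MI$ (where $A\prec B$ means that $B-A$ is positive definite) and $\|\nabla^2f(y)-\nabla^2f(z)\|_\infty\le L\|y-z\|_\infty$. Algorithm DINASC. $\|\cdot\|$ is an arbitrary norm on $\mathbb R^n$. Inputs: $y^0\in\mathbb R^n$, $\gamma_0>0$, $q\in(0,1)$, forcing terms $\eta_k$ with $0\le\eta_k\le\eta_{\max}<1$ for a constant $\eta_{\max}$. At iteration $k$: (1) compute $d^k$ such that $\|\nabla^2f(y^k)d^k-\nabla f(y^k)\|\le\eta_k\|\nabla f(y^k)\|$; (2) set $\alpha_k=\min\left\{1,\frac{1-\eta_k}{(1+\eta_k)^2}\gamma_k\frac1{\|\nabla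 f(y^k)\|}\right\}$ (equal to $1$ if $\nabla f(y^k)=0$); (3) compute the trial point $\hat y=y^k-\alpha_kd^k$; (4) if either [$\alpha_k<1$ and $\|\nabla f(\hat y)\|\le\|\nabla f(y^k)\|-\frac12\frac{(1-\eta_k)^2}{(1+\eta_k)^2}\gamma_k$] or [$\alpha_k=1$ and $\|\nabla f(\hat y)\|\le\eta_k\|\nabla f(y^k)\|+\frac1{2\gamma_k}(1+\eta_k)^2\|\nabla f(y^k)\|^2$], set $\gamma_{k+1}=\gamma_k$ and $y^{k+1}=\hat y$; otherwise replace $\gamma_k$ by $q\gamma_k$ and return to (2). Rates. With $e_k=\|y^k-y^*\|\to0$: linear means there is $c\in(0,1)$ with $e_{k+1}\le c\,e_k$ for all large $k$; superlinear means $e_{k+1}\le c_ke_k$ for all large $k$ with $c_k\to0$; quadratic means there is $c>0$ with $e_{k+1}\le c\,e_k^2$ for all large $k$. Linear convergence in (a) is with respect to the norm $\|\cdot\|$ of the algorithm. *)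

theory Defs
  imports "HOL-Analysis.Analysis"
begin

definition gradient :: "('a::real_inner \<Rightarrow> real) \<Rightarrow> 'a \<Rightarrow> 'a" where
  "gradient f x = (THE D. GDERIV f x :> D)"

definition hessian :: "(real^'n \<Rightarrow> real) \<Rightarrow> real^'n \<Rightarrow> real^'n^'n" where
  "hessian f x = jacobian (gradient f) (at x)"

definition twice_continuously_differentiable :: "(real^'n \<Rightarrow> real) \<Rightarrow> bool" where
  "twice_continuously_differentiable f \<longleftrightarrow>
     (\<forall>x. f differentiable (at x)) \<and>
     (\<forall>x. gradient f differentiable (at x)) \<and>
     continuous_on UNIV (hessian f)"

lemma GDERIV_gradient:
  fixes f :: "'a::euclidean_space \<Rightarrow> real"
  assumes "f differentiable (at x)"
  shows "GDERIV f x :> gradient f x"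
proof -
  obtain F where F: "(f has_derivative F) (at x)"
    using assms by (auto simp: differentiable_def)
  then interpret F: linear F by (rule has_derivative_linear)
  have "F h = inner h (adjoint F 1)" for h
    using adjoint_works[OF F.linear_axioms, of h 1] by simp
  then have G: "GDERIV f x :> adjoint F 1"
    using F unfolding gderiv_def by (metis (no_types, lifting) ext)
  have "D = D'" if "GDERIV f x :> D" "GDERIV f x :> D'" for D D'
  proof -
    have "(\<lambda>h. inner h D) = (\<lambda>h. inner h D')"
      using that unfolding gderiv_def by (rule has_derivative_unique)
    then show ?thesis by (metis vector_eq_ldot)
  qed
  with G show ?thesis unfolding gradient_def by (metis theI)
qed

lemma has_derivative_gradient_hessian:
  assumes "twice_continuously_differentiable f"
  shows "(gradient f has_derivative (\<lambda>h. hessian f x *v h)) (at x)"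
  using assms
  by (simp add: twice_continuously_differentiable_def hessian_def jacobian_works[symmetric])

definition strongly_convex :: "('a::real_normed_vector \<Rightarrow> real) \<Rightarrow> bool" where
  "strongly_convex f \<longleftrightarrow> (\<exists>m>0. \<forall>x z t. 0 \<le> t \<and> t \<le> 1 \<longrightarrow>
     f ((1 - t) *\<^sub>R x + t *\<^sub>R z)
       \<le> (1 - t) * f x + t * f z - m / 2 * t * (1 - t) * (norm (x - z))\<^sup>2)"

text \<open>Symmetry is not part of the definition: below it is applied only to differences of
  Hessians of twice continuously differentiable functions and multiples of the identity,
  which are symmetric anyway.\<close>

definition positive_definite :: "real^'n^'n \<Rightarrow> bool" where
  "positive_definite A \<longleftrightarrow> (\<forall>x. x \<noteq> 0 \<longrightarrow> 0 < x \<bullet> (A *v x))"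

text \<open>The matrix norm induced by the maximum norm on vectors, written in the style of \<open>onorm\<close>.\<close>

definition matrix_infnorm :: "real^'n^'n \<Rightarrow> real" where
  "matrix_infnorm A = (SUP x. infnorm (A *v x) / infnorm x)"

definition row_sum_norm :: "real^'n^'n \<Rightarrow> real" where
  "row_sum_norm A = Max (range (\<lambda>i. \<Sum>j\<in>UNIV. \<bar>A $ i $ j\<bar>))"

lemma infnorm_le_cart:
  fixes x :: "real^'n"
  assumes "\<And>i. \<bar>x $ i\<bar> \<le> c"
  shows "infnorm x \<le> c"
  unfolding infnorm_cart by (rule cSup_least) (use assms in auto)

lemma infnorm_matrix_vector_le_row_sum_norm:
  fixes A :: "real^'n^'n"
  shows "infnorm (A *v x) \<le> row_sum_norm A * infnorm x"
proof (rule infnorm_le_cart)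
  fix i
  have "\<bar>(A *v x) $ i\<bar> \<le> (\<Sum>j\<in>UNIV. \<bar>A $ i $ j\<bar> * \<bar>x $ j\<bar>)"
    unfolding matrix_vector_mult_def by (simp add: sum_abs[THEN order_trans] abs_mult[symmetric])
  also have "\<dots> \<le> (\<Sum>j\<in>UNIV. \<bar>A $ i $ j\<bar> * infnorm x)"
    by (intro sum_mono mult_left_mono component_le_infnorm_cart) auto
  also have "\<dots> = (\<Sum>j\<in>UNIV. \<bar>A $ i $ j\<bar>) * infnorm x"
    by (simp add: sum_distrib_right)
  also have "\<dots> \<le> row_sum_norm A * infnorm x"
    unfolding row_sum_norm_def by (intro mult_right_mono Max_ge infnorm_pos_le) auto
  finally show "\<bar>(A *v x) $ i\<bar> \<le> row_sum_norm A * infnorm x" .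
qed

lemma row_sum_norm_nonneg: "0 \<le> row_sum_norm A"
proof -
  have "0 \<le> (\<Sum>j\<in>UNIV. \<bar>A $ undefined $ j\<bar>)" by (simp add: sum_nonneg)
  also have "\<dots> \<le> row_sum_norm A" unfolding row_sum_norm_def by (intro Max_ge) auto
  finally show ?thesis .
qed

lemma matrix_infnorm_eq_row_sum_norm: "matrix_infnorm A = row_sum_norm A"
proof (rule antisym)
  have q: "infnorm (A *v x) / infnorm x \<le> row_sum_norm A" for x
    using infnorm_matrix_vector_le_row_sum_norm[of A x] infnorm_pos_lt[of x] row_sum_norm_nonneg[of A]
    by (cases "x = 0") (auto simp: infnorm_0 divide_le_eq)
  then show "matrix_infnorm A \<le> row_sum_norm A"
    unfolding matrix_infnorm_def by (intro cSUP_least) auto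
  have bdd: "bdd_above (range (\<lambda>x. infnorm (A *v x) / infnorm x))"
    using q by (auto intro!: bdd_aboveI)
  have "row_sum_norm A \<in> range (\<lambda>i. \<Sum>j\<in>UNIV. \<bar>A $ i $ j\<bar>)"
    unfolding row_sum_norm_def by (intro Max_in) auto
  then obtain i where i: "row_sum_norm A = (\<Sum>j\<in>UNIV. \<bar>A $ i $ j\<bar>)" by auto
  define x :: "real^'a" where "x = (\<chi> j. if A $ i $ j < 0 then -1 else 1)"
  have xj: "\<bar>x $ j\<bar> = 1" for j by (simp add: x_def)
  have "infnorm x = 1"
    using infnorm_le_cart[of x 1] component_le_infnorm_cart[of x i] xj by (auto intro: antisym)
  moreover have "(A *v x) $ i = row_sum_norm A"
    unfolding i matrix_vector_mult_def x_def by (auto intro!: sum.cong)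
  then have "row_sum_norm A \<le> infnorm (A *v x)"
    using component_le_infnorm_cart[of "A *v x" i] by auto
  ultimately have "row_sum_norm A \<le> infnorm (A *v x) / infnorm x" by simp
  also have "\<dots> \<le> matrix_infnorm A"
    unfolding matrix_infnorm_def by (rule cSUP_upper[OF _ bdd]) simp
  finally show "row_sum_norm A \<le> matrix_infnorm A" .
qed

definition assumption_A3 :: "(real^'n \<Rightarrow> real) \<Rightarrow> real \<Rightarrow> real \<Rightarrow> real \<Rightarrow> bool" where
  "assumption_A3 f \<mu> M L \<longleftrightarrow>
     twice_continuously_differentiable f \<and> strongly_convex f \<and>
     0 < \<mu> \<and> \<mu> < M \<and> 0 < L \<and>
     (\<forall>y. positive_definite (hessian f y - mat \<mu>) \<and>
          positive_definite (mat M - hessian f y)) \<and>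
     (\<forall>y z. matrix_infnorm (hessian f y - hessian f z) \<le> L * infnorm (y - z))"

definition is_norm :: "('a::real_vector \<Rightarrow> real) \<Rightarrow> bool" where
  "is_norm N \<longleftrightarrow>
     (\<forall>x. 0 \<le> N x) \<and> (\<forall>x. N x = 0 \<longleftrightarrow> x = 0) \<and>
     (\<forall>c x. N (c *\<^sub>R x) = \<bar>c\<bar> * N x) \<and> (\<forall>x z. N (x + z) \<le> N x + N z)"

text \<open>In the next three definitions, \<open>\<eta>\<close>, \<open>\<gamma>\<close>, \<open>y\<close> and \<open>d\<close> are the values of the forcing
  term, the step size parameter, the iterate and the direction within a single iteration.\<close>

definition dinasc_step ::
  "(real^'n \<Rightarrow> real) \<Rightarrow> (real^'n \<Rightarrow> real) \<Rightarrow> real \<Rightarrow> real \<Rightarrow> real^'n \<Rightarrow> real" where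
  "dinasc_step f N \<eta> \<gamma> y =
     (if gradient f y = 0 then 1
      else min 1 ((1 - \<eta>) / (1 + \<eta>)\<^sup>2 * \<gamma> * (1 / N (gradient f y))))"

definition dinasc_trial ::
  "(real^'n \<Rightarrow> real) \<Rightarrow> (real^'n \<Rightarrow> real) \<Rightarrow> real \<Rightarrow> real \<Rightarrow> real^'n \<Rightarrow> real^'n \<Rightarrow> real^'n" where
  "dinasc_trial f N \<eta> \<gamma> y d = y - dinasc_step f N \<eta> \<gamma> y *\<^sub>R d"

definition dinasc_accept ::
  "(real^'n \<Rightarrow> real) \<Rightarrow> (real^'n \<Rightarrow> real) \<Rightarrow> real \<Rightarrow> real \<Rightarrow> real^'n \<Rightarrow> real^'n \<Rightarrow> bool" where
  "dinasc_accept f N \<eta> \<gamma> y d \<longleftrightarrow>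
     (dinasc_step f N \<eta> \<gamma> y < 1 \<and>
        N (gradient f (dinasc_trial f N \<eta> \<gamma> y d))
          \<le> N (gradient f y) - 1 / 2 * ((1 - \<eta>)\<^sup>2 / (1 + \<eta>)\<^sup>2) * \<gamma>) \<or>
     (dinasc_step f N \<eta> \<gamma> y = 1 \<and>
        N (gradient f (dinasc_trial f N \<eta> \<gamma> y d))
          \<le> \<eta> * N (gradient f y) + 1 / (2 * \<gamma>) * (1 + \<eta>)\<^sup>2 * (N (gradient f y))\<^sup>2)"

text \<open>\<open>y\<close> is a sequence of iterates generated from the initial point \<open>y 0\<close>. Here \<open>\<gamma> k\<close> is the
  value at the start of iteration \<open>k\<close> and \<open>j k\<close> counts the rejected trial points of that
  iteration; the direction \<open>d k\<close> is not recomputed after a rejection.\<close>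

definition dinasc ::
  "(real^'n \<Rightarrow> real) \<Rightarrow> (real^'n \<Rightarrow> real) \<Rightarrow> real \<Rightarrow> real \<Rightarrow> real \<Rightarrow> (nat \<Rightarrow> real)
     \<Rightarrow> (nat \<Rightarrow> real^'n) \<Rightarrow> bool" where
  "dinasc f N \<gamma>\<^sub>0 q \<eta>\<^sub>m\<^sub>a\<^sub>x \<eta> y \<longleftrightarrow>
     0 < \<gamma>\<^sub>0 \<and> 0 < q \<and> q < 1 \<and> \<eta>\<^sub>m\<^sub>a\<^sub>x < 1 \<and> (\<forall>k. 0 \<le> \<eta> k \<and> \<eta> k \<le> \<eta>\<^sub>m\<^sub>a\<^sub>x) \<and>
     (\<exists>\<gamma> d j. \<gamma> 0 = \<gamma>\<^sub>0 \<and>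
        (\<forall>k. N (hessian f (y k) *v d k - gradient f (y k)) \<le> \<eta> k * N (gradient f (y k)) \<and>
             (\<forall>i<j k. \<not> dinasc_accept f N (\<eta> k) (q ^ i * \<gamma> k) (y k) (d k)) \<and>
             dinasc_accept f N (\<eta> k) (q ^ j k * \<gamma> k) (y k) (d k) \<and>
             \<gamma> (Suc k) = q ^ j k * \<gamma> k \<and>
             y (Suc k) = dinasc_trial f N (\<eta> k) (q ^ j k * \<gamma> k) (y k) (d k)))"

definition unique_minimizer :: "('a \<Rightarrow> real) \<Rightarrow> 'a \<Rightarrow> bool" where
  "unique_minimizer f x \<longleftrightarrow>
     is_arg_min f (\<lambda>_. True) x \<and> (\<forall>z. is_arg_min f (\<lambda>_. True) z \<longrightarrow> z = x)"

definition linear_rate :: "(nat \<Rightarrow> real) \<Rightarrow> bool" where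
  "linear_rate e \<longleftrightarrow> e \<longlonglongrightarrow> 0 \<and>
     (\<exists>c. 0 < c \<and> c < 1 \<and> (\<forall>\<^sub>F k in sequentially. e (Suc k) \<le> c * e k))"

definition superlinear_rate :: "(nat \<Rightarrow> real) \<Rightarrow> bool" where
  "superlinear_rate e \<longleftrightarrow> e \<longlonglongrightarrow> 0 \<and>
     (\<exists>c. c \<longlonglongrightarrow> 0 \<and> (\<forall>\<^sub>F k in sequentially. e (Suc k) \<le> c k * e k))"

definition quadratic_rate :: "(nat \<Rightarrow> real) \<Rightarrow> bool" where
  "quadratic_rate e \<longleftrightarrow> e \<longlonglongrightarrow> 0 \<and>
     (\<exists>c>0. \<forall>\<^sub>F k in sequentially. e (Suc k) \<le> c * (e k)\<^sup>2)"

end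

theory Submission
  imports Defs
begin

text \<open>Write \<open>g\<close> and \<open>H\<close> for the gradient and the Hessian of \<open>f\<close>. By coercivity, \<open>H\<close> has an
  inverse bounded uniformly in the point and \<open>g\<close> controls the distance to the minimizer; by the
  Lipschitz condition on \<open>H\<close>, linearizing \<open>g\<close> at any point leaves an error at most quadratic in
  the displacement. As all norms on a finite-dimensional space are equivalent, these bounds hold
  for the norm \<open>N\<close> of the algorithm with some constants \<open>C\<close> and \<open>K\<close>; the locale
  \<open>newton_bounds\<close> collects them, and everything about the iteration follows from them alone.

  For convergence, an inexact Newton direction damped by \<open>\<alpha>\<close> brings \<open>N g\<close> down to
  \<open>(1 - \<alpha> (1 - \<eta>)) N g\<close> up to an error quadratic in \<open>\<alpha> (1 + \<eta>) N g\<close>. With the step length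
  of the algorithm, both acceptance tests are exactly this estimate with \<open>1 / (2 \<gamma>)\<close> in place of
  the constant of the error term, so every sufficiently small \<open>\<gamma>\<close> is accepted
  (\<open>accept_if_small\<close>) and backtracking keeps \<open>\<gamma>\<close> away from 0
  (\<open>dinasc_step_size_bounded_below\<close>). Hence each iteration either lowers \<open>N g\<close> by a fixed amount
  or contracts it by a fixed factor (\<open>accept_gradient_decrease\<close>), which drives \<open>N g\<close> to 0 and the
  iterates to the minimizer.

  For the rates, a small gradient together with the lower bound on \<open>\<gamma>\<close> makes all late steps full.
  For a full step, with error \<open>e\<close> before it and \<open>e'\<close> after it,
  \<open>e' \<le> C (K e\<^sup>2 + \<eta> N g)\<close> (\<open>full_step_error\<close>), and \<open>N g \<le> B e\<close> near the minimizer.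
  So \<open>e'\<close> is at most \<open>C K e + C B \<eta>\<close> times \<open>e\<close>, and the three rates are read off from how
  large \<open>\<eta>\<close> is: below \<open>1 / (2 C B)\<close>, tending to 0, or of order \<open>e\<close>.\<close>

section \<open>Norms on Euclidean space\<close>

lemma is_norm_sub:
  assumes "is_norm N"
  shows "N (x - z) \<le> N x + N z"
proof -
  have "N ((- 1) *\<^sub>R z) = N z"
    using assms unfolding is_norm_def by (metis abs_minus_cancel abs_one mult_1)
  moreover have "N (x + (- 1) *\<^sub>R z) \<le> N x + N ((- 1) *\<^sub>R z)"
    using assms unfolding is_norm_def by blast
  ultimately show ?thesis by simp
qed

lemma is_norm_minus_commute:
  assumes "is_norm N"
  shows "N (x - z) = N (z - x)"
proof -
  have "N ((- 1) *\<^sub>R (x - z)) = N (x - z)"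
    using assms unfolding is_norm_def by (metis abs_minus_cancel abs_one mult_1)
  then show ?thesis by simp
qed

lemma is_norm_equivalent_norm:
  fixes N :: "'a::euclidean_space \<Rightarrow> real"
  assumes N: "is_norm N"
  obtains a b where "0 < a" "0 < b" "\<And>x. a * norm x \<le> N x" "\<And>x. N x \<le> b * norm x"
proof -
  have nonneg: "0 \<le> N x" and zero: "N x = 0 \<longleftrightarrow> x = 0"
    and scale: "N (c *\<^sub>R x) = \<bar>c\<bar> * N x" and tri: "N (x + z) \<le> N x + N z" for x z c
    using N unfolding is_norm_def by blast+
  define b where "b = (\<Sum>i\<in>Basis. N i) + 1"
  have "0 \<le> (\<Sum>i\<in>(Basis::'a set). N i)" by (intro sum_nonneg nonneg)
  then have b: "0 < b" unfolding b_def by linarith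
  have sum_le: "N (\<Sum>i\<in>I. h i) \<le> (\<Sum>i\<in>I. N (h i))" if "finite I" for I and h :: "'a \<Rightarrow> 'a"
    using that
  proof (induction I rule: finite_induct)
    case empty
    then show ?case using zero[of 0] by simp
  next
    case (insert i I)
    then show ?case using tri[of "h i" "sum h I"] by simp
  qed
  have upper: "N x \<le> b * norm x" for x
  proof -
    have "N x = N (\<Sum>i\<in>Basis. (x \<bullet> i) *\<^sub>R i)" by (simp add: euclidean_representation)
    also have "\<dots> \<le> (\<Sum>i\<in>Basis. N ((x \<bullet> i) *\<^sub>R i))" by (rule sum_le) simp
    also have "\<dots> = (\<Sum>i\<in>Basis. \<bar>x \<bullet> i\<bar> * N i)" by (simp add: scale)
    also have "\<dots> \<le> (\<Sum>i\<in>Basis. norm x * N i)"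
      by (intro sum_mono mult_right_mono Basis_le_norm nonneg)
    also have "\<dots> = norm x * (\<Sum>i\<in>Basis. N i)" by (simp add: sum_distrib_left)
    also have "\<dots> \<le> b * norm x" unfolding b_def by (simp add: algebra_simps)
    finally show ?thesis .
  qed
  have "\<bar>N x - N z\<bar> \<le> N (x - z)" for x z
    using tri[of "x - z" z] tri[of "z - x" x] is_norm_minus_commute[OF N, of x z] by simp
  then have "\<bar>N x - N z\<bar> \<le> b * norm (x - z)" for x z
    using upper[of "x - z"] order_trans by blast
  then have "b-lipschitz_on UNIV N"
    using b by (intro lipschitz_onI) (auto simp: dist_norm)
  then have cont: "continuous_on (sphere 0 1) N"
    by (meson lipschitz_on_continuous_on continuous_on_subset top_greatest)
  \<comment> \<open>The lower constant is the minimum of \<open>N\<close> on the unit sphere.\<close>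
  obtain u where u: "u \<in> sphere 0 1" "\<And>x. x \<in> sphere 0 1 \<Longrightarrow> N u \<le> N x"
    using continuous_attains_inf[OF compact_sphere _ cont] by auto
  have "0 < N u" using u(1) nonneg[of u] zero[of u] by (force simp: less_le)
  moreover have "N u * norm x \<le> N x" for x
  proof (cases "x = 0")
    case False
    then have "N u \<le> N ((1 / norm x) *\<^sub>R x)" by (intro u(2)) simp
    then show ?thesis using False by (simp add: scale field_simps)
  qed (simp add: nonneg)
  ultimately show ?thesis using that[OF _ b] upper by blast
qed

section \<open>Strongly convex functions\<close>

text \<open>Compared with the minimum \<open>B\<close> of \<open>f\<close> on the unit ball, strong convexity along the ray
  through a point at distance \<open>r \<ge> 1\<close> from the origin forces growth of order \<open>r\<^sup>2\<close>, so
  a minimum over a large ball is global.\<close>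

lemma strongly_convex_unique_minimizer:
  fixes f :: "'a::euclidean_space \<Rightarrow> real"
  assumes sc: "strongly_convex f" and cont: "continuous_on UNIV f"
  obtains x where "unique_minimizer f x"
proof -
  obtain m where m: "0 < m" and conv: "\<And>x z t. 0 \<le> t \<Longrightarrow> t \<le> 1 \<Longrightarrow>
     f ((1 - t) *\<^sub>R x + t *\<^sub>R z)
       \<le> (1 - t) * f x + t * f z - m / 2 * t * (1 - t) * (norm (x - z))\<^sup>2"
    using sc unfolding strongly_convex_def by blast
  have cont': "continuous_on S f" for S using cont continuous_on_subset by blast
  have "cball (0::'a) 1 \<noteq> {}" by simp
  from continuous_attains_inf[OF compact_cball this cont']
  obtain u where u: "\<forall>x\<in>cball 0 1. f u \<le> f x" by blast
  define R where "R = 1 + 2 * (f 0 - f u) / m"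
  have f0u: "f u \<le> f 0" using u by simp
  then have R: "1 \<le> R" using m unfolding R_def by simp
  have far: "f 0 \<le> f x" if x: "R \<le> norm x" for x
  proof -
    define r where "r = norm x"
    have r: "1 \<le> r" "R \<le> r" using x R by (auto simp: r_def)
    have "f u \<le> f ((1 / r) *\<^sub>R x)" using r by (intro u[rule_format]) (simp add: r_def)
    also have "\<dots> \<le> (1 - 1 / r) * f 0 + 1 / r * f x - m / 2 * (1 / r) * (1 - 1 / r) * r\<^sup>2"
      using conv[of "1 / r" 0 x] r by (simp add: r_def[symmetric])
    finally have "r * f u \<le> r * ((1 - 1 / r) * f 0 + 1 / r * f x - m / 2 * (1 / r) * (1 - 1 / r) * r\<^sup>2)"
      using r by (intro mult_left_mono) auto
    also have "\<dots> = (r - 1) * f 0 + f x - m / 2 * (r - 1) * r"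
      using r by (simp add: field_simps power2_eq_square)
    finally have "f 0 + r * (m / 2 * (r - 1) - (f 0 - f u)) \<le> f x" by (simp add: algebra_simps)
    moreover have "f 0 - f u \<le> m / 2 * (r - 1)"
      using r(2) m unfolding R_def by (simp add: field_simps)
    then have "0 \<le> r * (m / 2 * (r - 1) - (f 0 - f u))" using r by simp
    ultimately show ?thesis by linarith
  qed
  have "cball (0::'a) R \<noteq> {}" using R by simp
  from continuous_attains_inf[OF compact_cball this cont']
  obtain v where v: "\<forall>x\<in>cball 0 R. f v \<le> f x" by blast
  have v0: "f v \<le> f 0" using v R by simp
  have min: "f v \<le> f x" for x
  proof (cases "norm x \<le> R")
    case False
    then show ?thesis using far[of x] v0 by linarith
  qed (use v in simp)
  have "z = v" if z: "\<And>x. f z \<le> f x" for z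
  proof (rule ccontr)
    assume "z \<noteq> v"
    then have "0 < m / 2 * (1 / 2) * (1 - 1 / 2) * (norm (v - z))\<^sup>2" using m by simp
    moreover have "f v = f z" using z min by (simp add: antisym)
    moreover have "f v \<le> f ((1 - 1 / 2) *\<^sub>R v + (1 / 2) *\<^sub>R z)" by (rule min)
    ultimately show False using conv[of "1/2" v z] by simp
  qed
  then have "unique_minimizer f v"
    unfolding unique_minimizer_def is_arg_min_def using min by (auto simp: not_less)
  then show ?thesis using that by blast
qed

lemma gradient_minimizer_eq_0:
  fixes f :: "'a::euclidean_space \<Rightarrow> real"
  assumes "f differentiable (at x)" "unique_minimizer f x"
  shows "gradient f x = 0"
proof -
  have "(f has_derivative (\<lambda>h. h \<bullet> gradient f x)) (at x)"
    using GDERIV_gradient[OF assms(1)] by (simp add: gderiv_def)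
  then have "(\<lambda>h. h \<bullet> gradient f x) = (\<lambda>h. 0)"
    using assms(2) unfolding unique_minimizer_def is_arg_min_def
    by (intro differential_zero_maxmin[of x UNIV f]) (auto simp: not_less)
  then have "gradient f x \<bullet> gradient f x = 0" by metis
  then show ?thesis by simp
qed

section \<open>Consequences of the Hessian bounds\<close>

lemma hessian_coercive:
  fixes f :: "real^'n \<Rightarrow> real"
  assumes "assumption_A3 f \<mu> M L"
  shows "\<mu> * (norm h)\<^sup>2 \<le> h \<bullet> (hessian f y *v h)"
proof (cases "h = 0")
  case False
  then have "0 < h \<bullet> ((hessian f y - mat \<mu>) *v h)"
    using assms unfolding assumption_A3_def positive_definite_def by blast
  moreover have "mat \<mu> *v h = \<mu> *\<^sub>R h"
    by (simp add: vec_eq_iff matrix_vector_mult_def mat_def if_distrib[of "\<lambda>a. a * _"] cong: if_cong)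
  ultimately show ?thesis
    by (simp add: matrix_vector_mult_diff_rdistrib inner_diff_right power2_norm_eq_inner)
qed simp

lemma hessian_norm_lower_bound:
  fixes f :: "real^'n \<Rightarrow> real"
  assumes "assumption_A3 f \<mu> M L"
  shows "\<mu> * norm h \<le> norm (hessian f y *v h)"
proof (cases "h = 0")
  case False
  have "\<mu> * norm h * norm h \<le> norm (hessian f y *v h) * norm h"
    using hessian_coercive[OF assms, of h y] norm_cauchy_schwarz[of h "hessian f y *v h"]
    by (simp add: power2_eq_square mult_ac)
  then show ?thesis using False by simp
qed simp

text \<open>Strong monotonicity of the gradient: the mean value theorem applied to the component of
  the gradient along the segment reduces it to coercivity of the Hessian.\<close>

lemma gradient_norm_lower_bound:
  fixes f :: "real^'n \<Rightarrow> real"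
  assumes A3: "assumption_A3 f \<mu> M L"
  shows "\<mu> * norm (y - z) \<le> norm (gradient f y - gradient f z)"
proof (cases "y = z")
  case False
  have C2: "twice_continuously_differentiable f" using A3 unfolding assumption_A3_def by blast
  define h where "h = y - z"
  have der: "((\<lambda>t. gradient f (z + t *\<^sub>R h) \<bullet> h) has_derivative
      (\<lambda>s. (hessian f (z + t *\<^sub>R h) *v (s *\<^sub>R h)) \<bullet> h)) (at t within {0..1})" for t
  proof -
    have "((\<lambda>t. z + t *\<^sub>R h) has_derivative (\<lambda>s. s *\<^sub>R h)) (at t within {0..1})"
      by (auto intro!: derivative_eq_intros)
    from has_derivative_compose[OF this has_derivative_gradient_hessian[OF C2]]
    show ?thesis by (rule has_derivative_inner_left)
  qed
  obtain t where "gradient f (z + 1 *\<^sub>R h) \<bullet> h - gradient f (z + 0 *\<^sub>R h) \<bullet> h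
      = (hessian f (z + t *\<^sub>R h) *v ((1 - 0) *\<^sub>R h)) \<bullet> h"
    using mvt_simple[OF zero_less_one der] by blast
  then have "(gradient f y - gradient f z) \<bullet> h = h \<bullet> (hessian f (z + t *\<^sub>R h) *v h)"
    unfolding h_def by (simp add: inner_diff_left inner_commute[of "hessian f _ *v _"])
  then have "\<mu> * (norm h)\<^sup>2 \<le> (gradient f y - gradient f z) \<bullet> h"
    using hessian_coercive[OF A3] by metis
  also have "\<dots> \<le> norm (gradient f y - gradient f z) * norm h" by (rule norm_cauchy_schwarz)
  finally show ?thesis using False by (simp add: power2_eq_square h_def)
qed simp

text \<open>The induced matrix norm is taken with respect to \<open>infnorm\<close>; comparing \<open>infnorm\<close> with the
  Euclidean norm costs the factor \<open>sqrt n\<close>.\<close>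

lemma gradient_linearization_error:
  fixes f :: "real^'n \<Rightarrow> real"
  assumes A3: "assumption_A3 f \<mu> M L"
  shows "norm (gradient f (y + h) - gradient f y - hessian f y *v h)
    \<le> sqrt (real CARD('n)) * L * (norm h)\<^sup>2"
proof -
  define c where "c = sqrt (real CARD('n)) * L"
  have C2: "twice_continuously_differentiable f" and L: "0 < L"
    and lip: "\<And>y z. matrix_infnorm (hessian f y - hessian f z) \<le> L * infnorm (y - z)"
    using A3 unfolding assumption_A3_def by blast+
  have c: "0 \<le> c" using L by (simp add: c_def)
  have hess: "norm ((hessian f z - hessian f y) *v x) \<le> c * norm (z - y) * norm x" for z x
  proof -
    let ?A = "hessian f z - hessian f y"
    have "norm (?A *v x) \<le> sqrt (real CARD('n)) * infnorm (?A *v x)"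
      using norm_le_infnorm[of "?A *v x"] by simp
    also have "\<dots> \<le> sqrt (real CARD('n)) * (matrix_infnorm ?A * infnorm x)"
      unfolding matrix_infnorm_eq_row_sum_norm
      by (intro mult_left_mono infnorm_matrix_vector_le_row_sum_norm) simp
    also have "\<dots> \<le> sqrt (real CARD('n)) * ((L * infnorm (z - y)) * infnorm x)"
      by (intro mult_left_mono mult_right_mono lip) (simp_all add: infnorm_pos_le)
    also have "\<dots> \<le> sqrt (real CARD('n)) * ((L * norm (z - y)) * norm x)"
      using L by (intro mult_left_mono mult_mono infnorm_le_norm) (simp_all add: infnorm_pos_le)
    finally show ?thesis by (simp add: c_def mult_ac)
  qed
  have "norm (gradient f (y + h) - gradient f y - hessian f y *v ((y + h) - y))
      \<le> norm ((y + h) - y) * (c * norm h)"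
  proof (rule differentiable_bound_linearization[where S = "cball y (norm h)" and f' = "\<lambda>z x. hessian f z *v x"])
    show "y + t *\<^sub>R ((y + h) - y) \<in> cball y (norm h)" if "t \<in> {0..1}" for t
      using that by (simp add: dist_norm mult_left_le_one_le)
    show "(gradient f has_derivative (\<lambda>x. hessian f z *v x)) (at z within cball y (norm h))" for z
      by (rule has_derivative_at_withinI[OF has_derivative_gradient_hessian[OF C2]])
    show "onorm ((*v) (hessian f z) - (*v) (hessian f y)) \<le> c * norm h"
      if z: "z \<in> cball y (norm h)" for z
    proof (rule onorm_bound)
      show "0 \<le> c * norm h" using c by simp
      fix x
      have "norm (hessian f z *v x - hessian f y *v x) \<le> c * norm (z - y) * norm x"
        using hess[of z x] by (simp add: matrix_vector_mult_diff_rdistrib)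
      also have "\<dots> \<le> c * norm h * norm x"
        using z c by (intro mult_right_mono mult_left_mono) (auto simp: dist_norm norm_minus_commute)
      finally show "norm (((*v) (hessian f z) - (*v) (hessian f y)) x) \<le> c * norm h * norm x" by simp
    qed
    show "y \<in> cball y (norm h)" by simp
  qed
  then show ?thesis by (simp add: c_def power2_eq_square mult_ac)
qed

section \<open>Inexact Newton steps\<close>

locale newton_bounds =
  fixes f :: "real^'n \<Rightarrow> real" and N :: "real^'n \<Rightarrow> real" and C K :: real
  assumes is_norm: "is_norm N" and C_pos: "0 < C" and K_pos: "0 < K"
    and hessian_inverse_bound: "N h \<le> C * N (hessian f y *v h)"
    and gradient_inverse_bound: "N (y - z) \<le> C * N (gradient f y - gradient f z)"
    and linearization_bound:
      "N (gradient f (y + h) - gradient f y - hessian f y *v h) \<le> K * (N h)\<^sup>2"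
begin

lemma N_nonneg [simp]: "0 \<le> N x"
  and N_eq_0 [simp]: "N x = 0 \<longleftrightarrow> x = 0"
  and N_scale: "N (c *\<^sub>R x) = \<bar>c\<bar> * N x"
  and N_add: "N (x + z) \<le> N x + N z"
  and N_sub: "N (x - z) \<le> N x + N z"
  using is_norm is_norm_sub[OF is_norm] unfolding is_norm_def by blast+

text \<open>The residual \<open>g - H d\<close> of the linear solve enters to first order in the step length,
  the curvature only to second order; this trade-off is what the step length rule balances.\<close>

lemma damped_step_gradient_bound:
  assumes \<alpha>: "0 \<le> \<alpha>" "\<alpha> \<le> 1"
    and d: "N (hessian f y *v d - gradient f y) \<le> \<eta> * N (gradient f y)"
  shows "N (gradient f (y - \<alpha> *\<^sub>R d)) \<le> (1 - \<alpha> * (1 - \<eta>)) * N (gradient f y)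
           + K * C\<^sup>2 * (\<alpha> * (1 + \<eta>) * N (gradient f y))\<^sup>2"
proof -
  let ?g = "gradient f y" and ?H = "hessian f y"
  let ?r = "gradient f (y + (- \<alpha>) *\<^sub>R d) - ?g - ?H *v ((- \<alpha>) *\<^sub>R d)"
  have "N (?H *v d) \<le> (1 + \<eta>) * N ?g"
    using N_add[of "?H *v d - ?g" ?g] d by (simp add: algebra_simps)
  then have "N d \<le> C * ((1 + \<eta>) * N ?g)"
    using hessian_inverse_bound[of d y] C_pos by (meson mult_left_mono less_imp_le order_trans)
  then have "\<alpha> * N d \<le> \<alpha> * (C * ((1 + \<eta>) * N ?g))" using \<alpha> by (intro mult_left_mono)
  then have "(N ((- \<alpha>) *\<^sub>R d))\<^sup>2 \<le> (\<alpha> * (C * ((1 + \<eta>) * N ?g)))\<^sup>2"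
    unfolding N_scale using \<alpha> by (intro power_mono) auto
  then have "K * (N ((- \<alpha>) *\<^sub>R d))\<^sup>2 \<le> K * (\<alpha> * (C * ((1 + \<eta>) * N ?g)))\<^sup>2"
    using K_pos by (intro mult_left_mono) auto
  then have r: "N ?r \<le> K * C\<^sup>2 * (\<alpha> * (1 + \<eta>) * N ?g)\<^sup>2"
    using linearization_bound[of y "(- \<alpha>) *\<^sub>R d"] by (simp add: power_mult_distrib mult_ac)
  have "?H *v ((- \<alpha>) *\<^sub>R d) = - (\<alpha> *\<^sub>R (?H *v d))"
    using matrix_vector_mult_scaleR[of ?H "- \<alpha>" d] by simp
  then have "gradient f (y - \<alpha> *\<^sub>R d) = ((1 - \<alpha>) *\<^sub>R ?g - \<alpha> *\<^sub>R (?H *v d - ?g)) + ?r"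
    by (simp add: algebra_simps)
  then have "N (gradient f (y - \<alpha> *\<^sub>R d))
      \<le> N ((1 - \<alpha>) *\<^sub>R ?g - \<alpha> *\<^sub>R (?H *v d - ?g)) + N ?r"
    using N_add by metis
  also have "\<dots> \<le> (N ((1 - \<alpha>) *\<^sub>R ?g) + N (\<alpha> *\<^sub>R (?H *v d - ?g))) + N ?r"
    using N_sub by (intro add_right_mono)
  also have "\<dots> \<le> ((1 - \<alpha>) * N ?g + \<alpha> * (\<eta> * N ?g)) + N ?r"
    unfolding N_scale using \<alpha> mult_left_mono[OF d \<alpha>(1)] by simp
  finally show ?thesis using r by (simp add: algebra_simps)
qed

text \<open>The upper bound on \<open>\<gamma>\<close> says that \<open>1 / (2 \<gamma>)\<close> dominates the curvature constant \<open>K C\<^sup>2\<close>. A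
  damped step has \<open>\<alpha> N g = (1 - \<eta>) \<gamma> / (1 + \<eta>)\<^sup>2\<close>, for which the first-order decrease is twice
  the bound so obtained for the second-order error; half of it remains.\<close>

lemma accept_if_small:
  assumes \<eta>: "0 \<le> \<eta>" "\<eta> < 1" and \<gamma>: "0 < \<gamma>" "2 * K * C\<^sup>2 * \<gamma> \<le> 1"
    and d: "N (hessian f y *v d - gradient f y) \<le> \<eta> * N (gradient f y)"
  shows "dinasc_accept f N \<eta> \<gamma> y d"
proof -
  define G where "G = N (gradient f y)"
  define \<alpha> where "\<alpha> = dinasc_step f N \<eta> \<gamma> y"
  have G: "0 \<le> G" by (simp add: G_def)
  have \<alpha>: "0 \<le> \<alpha>" "\<alpha> \<le> 1" using \<eta> \<gamma> by (auto simp: \<alpha>_def dinasc_step_def)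
  have curvature: "K * C\<^sup>2 \<le> 1 / (2 * \<gamma>)" using \<gamma> by (simp add: field_simps)
  have "N (gradient f (y - \<alpha> *\<^sub>R d)) \<le> (1 - \<alpha> * (1 - \<eta>)) * G + K * C\<^sup>2 * (\<alpha> * (1 + \<eta>) * G)\<^sup>2"
    unfolding G_def by (rule damped_step_gradient_bound[OF \<alpha> d])
  also have "\<dots> \<le> (1 - \<alpha> * (1 - \<eta>)) * G + 1 / (2 * \<gamma>) * (\<alpha> * (1 + \<eta>) * G)\<^sup>2"
    using curvature by (intro add_left_mono mult_right_mono) auto
  finally have bound: "N (gradient f (y - \<alpha> *\<^sub>R d))
      \<le> (1 - \<alpha> * (1 - \<eta>)) * G + 1 / (2 * \<gamma>) * (\<alpha> * (1 + \<eta>) * G)\<^sup>2" .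
  show ?thesis
  proof (cases "\<alpha> = 1")
    case True
    then have "N (gradient f (dinasc_trial f N \<eta> \<gamma> y d))
        \<le> \<eta> * G + 1 / (2 * \<gamma>) * (1 + \<eta>)\<^sup>2 * G\<^sup>2"
      using bound by (simp add: dinasc_trial_def \<alpha>_def[symmetric] power_mult_distrib)
    then show ?thesis using True unfolding dinasc_accept_def \<alpha>_def G_def by blast
  next
    case False
    then have "gradient f y \<noteq> 0" and "\<alpha> = (1 - \<eta>) / (1 + \<eta>)\<^sup>2 * \<gamma> * (1 / G)"
      using \<alpha> by (auto simp: \<alpha>_def dinasc_step_def G_def min_def split: if_splits)
    then have \<alpha>G: "\<alpha> * G = (1 - \<eta>) / (1 + \<eta>)\<^sup>2 * \<gamma>" by (simp add: G_def)
    define s where "s = (1 - \<eta>)\<^sup>2 / (1 + \<eta>)\<^sup>2"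
    have one: "\<alpha> * (1 - \<eta>) * G = s * \<gamma>"
    proof -
      have "\<alpha> * (1 - \<eta>) * G = (1 - \<eta>) * (\<alpha> * G)" by simp
      also have "\<dots> = s * \<gamma>" unfolding \<alpha>G by (simp add: s_def power2_eq_square)
      finally show ?thesis .
    qed
    have "\<alpha> * (1 + \<eta>) * G = (1 - \<eta>) / (1 + \<eta>) * \<gamma>"
    proof -
      have "\<alpha> * (1 + \<eta>) * G = (1 + \<eta>) * (\<alpha> * G)" by simp
      also have "\<dots> = (1 - \<eta>) / (1 + \<eta>) * \<gamma>"
        unfolding \<alpha>G using \<eta> by (simp add: power2_eq_square)
      finally show ?thesis .
    qed
    then have two: "1 / (2 * \<gamma>) * (\<alpha> * (1 + \<eta>) * G)\<^sup>2 = 1 / 2 * s * \<gamma>"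
      using \<gamma> by (simp add: s_def power_mult_distrib power_divide power2_eq_square)
    have "N (gradient f (y - \<alpha> *\<^sub>R d)) \<le> G - 1 / 2 * s * \<gamma>"
      using bound one two by (simp add: algebra_simps)
    then show ?thesis
      using False \<alpha> unfolding dinasc_accept_def dinasc_trial_def \<alpha>_def[symmetric] G_def[symmetric] s_def
      by simp
  qed
qed

text \<open>A damped step lowers the gradient norm by a fixed amount. A full step is taken only when
  \<open>(1 + \<eta>)\<^sup>2 * N g \<le> (1 - \<eta>) * \<gamma>\<close>, which turns the quadratic term of its acceptance
  test into at most \<open>(1 - \<eta>) / 2\<close> times \<open>N g\<close>.\<close>

lemma accept_gradient_decrease:
  assumes acc: "dinasc_accept f N \<eta> \<gamma> y d"
    and \<eta>: "0 \<le> \<eta>" "\<eta> \<le> \<eta>\<^sub>m" "\<eta>\<^sub>m < 1" and \<gamma>: "0 < \<gamma>\<^sub>m" "\<gamma>\<^sub>m \<le> \<gamma>"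
  shows "N (gradient f (dinasc_trial f N \<eta> \<gamma> y d)) \<le> N (gradient f y) - (1 - \<eta>\<^sub>m)\<^sup>2 / 8 * \<gamma>\<^sub>m \<or>
         N (gradient f (dinasc_trial f N \<eta> \<gamma> y d)) \<le> (1 + \<eta>\<^sub>m) / 2 * N (gradient f y)"
proof -
  define G where "G = N (gradient f y)"
  define G' where "G' = N (gradient f (dinasc_trial f N \<eta> \<gamma> y d))"
  have G: "0 \<le> G" by (simp add: G_def)
  consider "G' \<le> G - 1 / 2 * ((1 - \<eta>)\<^sup>2 / (1 + \<eta>)\<^sup>2) * \<gamma>"
    | "dinasc_step f N \<eta> \<gamma> y = 1" "G' \<le> \<eta> * G + 1 / (2 * \<gamma>) * (1 + \<eta>)\<^sup>2 * G\<^sup>2"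
    using acc unfolding dinasc_accept_def G_def G'_def by blast
  then show ?thesis
  proof cases
    case 1
    have "(1 - \<eta>\<^sub>m)\<^sup>2 / 2\<^sup>2 \<le> (1 - \<eta>)\<^sup>2 / (1 + \<eta>)\<^sup>2"
      using \<eta> by (intro frac_le power_mono) auto
    then have "(1 - \<eta>\<^sub>m)\<^sup>2 / 2\<^sup>2 * \<gamma>\<^sub>m \<le> (1 - \<eta>)\<^sup>2 / (1 + \<eta>)\<^sup>2 * \<gamma>"
      using \<gamma> by (intro mult_mono) auto
    moreover have "G' \<le> G - t / 8 * \<gamma>\<^sub>m"
      if "t / 2\<^sup>2 * \<gamma>\<^sub>m \<le> s * \<gamma>" "G' \<le> G - 1 / 2 * s * \<gamma>" for s t
      using that by simp
    ultimately have "G' \<le> G - (1 - \<eta>\<^sub>m)\<^sup>2 / 8 * \<gamma>\<^sub>m" using 1 by blast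
    then show ?thesis unfolding G_def G'_def by blast
  next
    case 2
    have full: "(1 + \<eta>)\<^sup>2 * G \<le> (1 - \<eta>) * \<gamma>"
    proof (cases "gradient f y = 0")
      case True
      then have "G = 0" by (simp add: G_def)
      then show ?thesis using \<eta> \<gamma> by simp
    next
      case False
      then have "0 < G" using G by (simp add: G_def less_le)
      then show ?thesis using 2(1) False \<eta>
        by (simp add: dinasc_step_def G_def[symmetric] min_def field_simps split: if_splits)
    qed
    have "1 / (2 * \<gamma>) * (1 + \<eta>)\<^sup>2 * G\<^sup>2 = G / (2 * \<gamma>) * ((1 + \<eta>)\<^sup>2 * G)"
      by (simp add: power2_eq_square)
    also have "\<dots> \<le> G / (2 * \<gamma>) * ((1 - \<eta>) * \<gamma>)"
      using full G \<gamma> by (intro mult_left_mono) auto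
    also have "\<dots> = (1 - \<eta>) / 2 * G" using \<gamma> by simp
    finally have "G' \<le> (1 + \<eta>) / 2 * G" using 2(2) by (simp add: field_simps)
    also have "\<dots> \<le> (1 + \<eta>\<^sub>m) / 2 * G" using \<eta> G by (intro mult_right_mono) auto
    finally show ?thesis unfolding G_def G'_def by blast
  qed
qed

text \<open>Multiplying the error of a full step by the Hessian at \<open>y\<close> splits it into the
  linearization error of the gradient and the residual of the linear solve.\<close>

lemma full_step_error:
  assumes zero: "gradient f y\<^sub>s = 0"
    and d: "N (hessian f y *v d - gradient f y) \<le> \<eta> * N (gradient f y)"
  shows "N (y - d - y\<^sub>s) \<le> C * (K * (N (y - y\<^sub>s))\<^sup>2 + \<eta> * N (gradient f y))"
proof -
  let ?r = "gradient f (y + (y\<^sub>s - y)) - gradient f y - hessian f y *v (y\<^sub>s - y)"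
  have "hessian f y *v (y - d - y\<^sub>s) = ?r - (hessian f y *v d - gradient f y)"
    using zero by (simp add: matrix_vector_mult_diff_distrib)
  then have "N (hessian f y *v (y - d - y\<^sub>s)) \<le> N ?r + N (hessian f y *v d - gradient f y)"
    using N_sub by metis
  also have "\<dots> \<le> K * (N (y - y\<^sub>s))\<^sup>2 + \<eta> * N (gradient f y)"
    using linearization_bound[of y "y\<^sub>s - y"] d is_norm_minus_commute[OF is_norm, of y y\<^sub>s]
    by (intro add_mono) auto
  finally show ?thesis
    using hessian_inverse_bound[of "y - d - y\<^sub>s" y] C_pos
    by (meson mult_left_mono less_imp_le order_trans)
qed

text \<open>At a stationary point the linearization bound reads \<open>g = H h + O(h\<^sup>2)\<close> with the fixed
  matrix \<open>H\<close>, and for displacements \<open>h\<close> of size at most 1 the quadratic term is absorbed in the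
  linear one.\<close>

lemma gradient_local_bound:
  assumes zero: "gradient f y\<^sub>s = 0"
  obtains B where "0 < B" "\<forall>y. N (y - y\<^sub>s) \<le> 1 \<longrightarrow> N (gradient f y) \<le> B * N (y - y\<^sub>s)"
proof -
  obtain a b where a: "0 < a" and b: "0 < b"
    and lower: "\<And>x. a * norm x \<le> N x" and upper: "\<And>x. N x \<le> b * norm x"
    using is_norm_equivalent_norm[OF is_norm] by blast
  define A where "A = onorm (\<lambda>x. hessian f y\<^sub>s *v x)"
  have A: "0 \<le> A" unfolding A_def by (rule onorm_pos_le) (simp add: matrix_vector_mul_bounded_linear)
  have hess: "N (hessian f y\<^sub>s *v x) \<le> b * A / a * N x" for x
  proof -
    have "N (hessian f y\<^sub>s *v x) \<le> b * norm (hessian f y\<^sub>s *v x)" by (rule upper)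
    also have "\<dots> \<le> b * (A * norm x)"
      using b unfolding A_def by (intro mult_left_mono onorm) (auto simp: matrix_vector_mul_bounded_linear)
    also have "\<dots> \<le> b * (A * (N x / a))"
      using b A a lower[of x] by (intro mult_left_mono) (auto simp: field_simps)
    finally show ?thesis by simp
  qed
  show ?thesis
  proof (rule that; (intro allI impI)?)
    show "0 < b * A / a + K" using a b A K_pos by (simp add: add_nonneg_pos)
    fix y assume near: "N (y - y\<^sub>s) \<le> 1"
    let ?h = "y - y\<^sub>s"
    have "gradient f y = (gradient f (y\<^sub>s + ?h) - gradient f y\<^sub>s - hessian f y\<^sub>s *v ?h) + hessian f y\<^sub>s *v ?h"
      using zero by simp
    then have "N (gradient f y)
        \<le> N (gradient f (y\<^sub>s + ?h) - gradient f y\<^sub>s - hessian f y\<^sub>s *v ?h) + N (hessian f y\<^sub>s *v ?h)"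
      using N_add by metis
    also have "\<dots> \<le> K * (N ?h)\<^sup>2 + b * A / a * N ?h"
      by (intro add_mono linearization_bound hess)
    also have "\<dots> \<le> K * N ?h + b * A / a * N ?h"
      using near K_pos by (intro add_right_mono mult_left_mono) (auto simp: power2_eq_square mult_left_le)
    finally show "N (gradient f y) \<le> (b * A / a + K) * N ?h" by (simp add: algebra_simps)
  qed
qed

end

section \<open>Convergence of the iteration\<close>

text \<open>The sequence never exceeds \<open>G 0\<close>, so subtracting \<open>c\<close> also amounts to
  multiplication by a factor bounded away from 1.\<close>

lemma decrease_or_contract_tendsto_0:
  fixes G :: "nat \<Rightarrow> real"
  assumes nonneg: "\<And>k. 0 \<le> G k" and c: "0 < c" and \<theta>: "0 \<le> \<theta>" "\<theta> < 1"
    and step: "\<And>k. G (Suc k) \<le> G k - c \<or> G (Suc k) \<le> \<theta> * G k"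
  shows "G \<longlonglongrightarrow> 0"
proof -
  define \<rho> where "\<rho> = max \<theta> (1 - c / (G 0 + 1))"
  have G0: "0 < G 0 + 1" using nonneg[of 0] by linarith
  have \<rho>: "0 \<le> \<rho>" "\<rho> < 1" using \<theta> c G0 by (auto simp: \<rho>_def)
  have "G (Suc k) \<le> G k" for k
  proof -
    have "\<theta> * G k \<le> G k" using \<theta> nonneg[of k] by (simp add: mult_left_le_one_le)
    then show ?thesis using step[of k] c by linarith
  qed
  then have "decseq G" by (simp add: decseq_Suc_iff)
  then have le0: "G k \<le> G 0" for k by (simp add: decseqD)
  have contract: "G (Suc k) \<le> \<rho> * G k" for k
  proof -
    have "c / (G 0 + 1) * G k \<le> c / (G 0 + 1) * (G 0 + 1)"
      using le0[of k] c G0 by (intro mult_left_mono) auto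
    then have "G k - c \<le> (1 - c / (G 0 + 1)) * G k" using G0 by (simp add: left_diff_distrib)
    also have "\<dots> \<le> \<rho> * G k" unfolding \<rho>_def by (intro mult_right_mono nonneg) simp
    finally have "G k - c \<le> \<rho> * G k" .
    moreover have "\<theta> * G k \<le> \<rho> * G k" unfolding \<rho>_def by (intro mult_right_mono nonneg) simp
    ultimately show ?thesis using step[of k] by linarith
  qed
  have geometric: "G k \<le> \<rho> ^ k * G 0" for k
  proof (induction k)
    case (Suc k)
    have "\<rho> * G k \<le> \<rho> * (\<rho> ^ k * G 0)" using Suc \<rho>(1) by (rule mult_left_mono)
    then show ?case using contract[of k] by simp
  qed simp
  show ?thesis
  proof (rule tendsto_sandwich[OF _ _ tendsto_const])
    show "(\<lambda>k. \<rho> ^ k * G 0) \<longlonglongrightarrow> 0"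
      by (rule tendsto_mult_left_zero[OF LIMSEQ_power_zero]) (use \<rho> in simp)
    show "\<forall>\<^sub>F k in sequentially. G k \<le> \<rho> ^ k * G 0" by (simp add: geometric)
    show "\<forall>\<^sub>F k in sequentially. 0 \<le> G k" by (simp add: nonneg)
  qed
qed

lemma dinasc_parameters:
  assumes "dinasc f N \<gamma>\<^sub>0 q \<eta>\<^sub>m \<eta> y"
  shows "0 < \<gamma>\<^sub>0" "0 < q" "q < 1" "\<eta>\<^sub>m < 1" "0 \<le> \<eta> k" "\<eta> k \<le> \<eta>\<^sub>m"
proof -
  have "0 < \<gamma>\<^sub>0 \<and> 0 < q \<and> q < 1 \<and> \<eta>\<^sub>m < 1 \<and> (\<forall>k. 0 \<le> \<eta> k \<and> \<eta> k \<le> \<eta>\<^sub>m)"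
    using assms unfolding dinasc_def by (elim conjE) (intro conjI)
  then show "0 < \<gamma>\<^sub>0" "0 < q" "q < 1" "\<eta>\<^sub>m < 1" "0 \<le> \<eta> k" "\<eta> k \<le> \<eta>\<^sub>m" by simp_all
qed

context newton_bounds
begin

text \<open>Here \<open>\<gamma> k\<close> is the parameter at which iteration \<open>k\<close> accepts its trial point, so that the
  backtracking no longer appears. The value rejected just before an accepted
  one exceeds \<open>1 / (2 K C\<^sup>2)\<close>, since smaller ones are always accepted; so backtracking cannot
  bring the parameter below \<open>q\<close> times this value.\<close>

lemma dinasc_step_size_bounded_below:
  assumes "dinasc f N \<gamma>\<^sub>0 q \<eta>\<^sub>m \<eta> y"
  obtains \<gamma>\<^sub>m \<gamma> d where "0 < \<gamma>\<^sub>m"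
    "\<And>k. \<gamma>\<^sub>m \<le> \<gamma> k"
    "\<And>k. N (hessian f (y k) *v d k - gradient f (y k)) \<le> \<eta> k * N (gradient f (y k))"
    "\<And>k. dinasc_accept f N (\<eta> k) (\<gamma> k) (y k) (d k)"
    "\<And>k. y (Suc k) = dinasc_trial f N (\<eta> k) (\<gamma> k) (y k) (d k)"
proof -
  note pos = dinasc_parameters(1-4)[OF assms] and \<eta> = dinasc_parameters(5,6)[OF assms]
  obtain \<gamma> d j where \<gamma>0: "\<gamma> 0 = \<gamma>\<^sub>0"
    and iter: "\<forall>k. N (hessian f (y k) *v d k - gradient f (y k)) \<le> \<eta> k * N (gradient f (y k)) \<and>
      (\<forall>i<j k. \<not> dinasc_accept f N (\<eta> k) (q ^ i * \<gamma> k) (y k) (d k)) \<and>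
      dinasc_accept f N (\<eta> k) (q ^ j k * \<gamma> k) (y k) (d k) \<and>
      \<gamma> (Suc k) = q ^ j k * \<gamma> k \<and>
      y (Suc k) = dinasc_trial f N (\<eta> k) (q ^ j k * \<gamma> k) (y k) (d k)"
    using assms unfolding dinasc_def by (elim conjE exE) (rule that)
  note d = iter[rule_format, THEN conjunct1]
    and rej = iter[rule_format, THEN conjunct2, THEN conjunct1, rule_format]
    and iter' = iter[rule_format, THEN conjunct2, THEN conjunct2]
  note \<gamma>Suc = iter'[THEN conjunct2, THEN conjunct1]
  note acc = iter'[THEN conjunct1, folded \<gamma>Suc]
    and ySuc = iter'[THEN conjunct2, THEN conjunct2, folded \<gamma>Suc]
  define \<kappa> where "\<kappa> = 2 * K * C\<^sup>2"
  have \<kappa>: "0 < \<kappa>" using K_pos C_pos by (simp add: \<kappa>_def)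
  define \<gamma>\<^sub>m where "\<gamma>\<^sub>m = min \<gamma>\<^sub>0 (q / \<kappa>)"
  have m: "0 < \<gamma>\<^sub>m" using pos \<kappa> by (simp add: \<gamma>\<^sub>m_def)
  have low: "\<gamma>\<^sub>m \<le> \<gamma> k" for k
  proof (induction k)
    case 0
    then show ?case by (simp add: \<gamma>0 \<gamma>\<^sub>m_def)
  next
    case (Suc k)
    show ?case
    proof (cases "j k")
      case 0
      then show ?thesis using Suc \<gamma>Suc[of k] by simp
    next
      case (Suc i)
      have "0 < \<gamma> k" using m \<open>\<gamma>\<^sub>m \<le> \<gamma> k\<close> by linarith
      then have "0 < q ^ i * \<gamma> k" using pos(2) by simp
      have "\<not> 2 * K * C\<^sup>2 * (q ^ i * \<gamma> k) \<le> 1"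
      proof
        assume "2 * K * C\<^sup>2 * (q ^ i * \<gamma> k) \<le> 1"
        then have "dinasc_accept f N (\<eta> k) (q ^ i * \<gamma> k) (y k) (d k)"
          by (rule accept_if_small[OF \<eta>(1) le_less_trans[OF \<eta>(2) pos(4)] \<open>0 < q ^ i * \<gamma> k\<close> _ d])
        moreover have "i < j k" by (simp add: Suc)
        ultimately show False using rej by blast
      qed
      then have "\<not> \<kappa> * (q ^ i * \<gamma> k) \<le> 1" unfolding \<kappa>_def .
      then have "1 / \<kappa> \<le> q ^ i * \<gamma> k" using \<kappa> by (simp add: divide_le_eq mult.commute)
      then have "q * (1 / \<kappa>) \<le> q * (q ^ i * \<gamma> k)" using pos(2) by (intro mult_left_mono) auto
      also have "\<dots> = \<gamma> (Suc k)" unfolding \<gamma>Suc Suc by simp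
      finally have "q / \<kappa> \<le> \<gamma> (Suc k)" by simp
      then show ?thesis unfolding \<gamma>\<^sub>m_def by linarith
    qed
  qed
  \<comment> \<open>The parameter accepted in iteration \<open>k\<close> is the one with which iteration \<open>k + 1\<close> starts.\<close>
  show ?thesis
    by (rule that[OF m, of "\<lambda>k. \<gamma> (Suc k)" d])
      (rule low d acc ySuc)+
qed

lemma dinasc_gradient_tendsto_0:
  assumes run: "dinasc f N \<gamma>\<^sub>0 q \<eta>\<^sub>m \<eta> y"
  shows "(\<lambda>k. N (gradient f (y k))) \<longlonglongrightarrow> 0"
proof -
  note \<eta> = dinasc_parameters(4-6)[OF run]
  have \<eta>\<^sub>m: "0 \<le> \<eta>\<^sub>m" using order_trans[OF \<eta>(2)[of 0] \<eta>(3)[of 0]] .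
  obtain \<gamma>\<^sub>m \<gamma> d where m: "0 < \<gamma>\<^sub>m" and low: "\<And>k. \<gamma>\<^sub>m \<le> \<gamma> k"
    and d: "\<And>k. N (hessian f (y k) *v d k - gradient f (y k)) \<le> \<eta> k * N (gradient f (y k))"
    and acc: "\<And>k. dinasc_accept f N (\<eta> k) (\<gamma> k) (y k) (d k)"
    and ySuc: "\<And>k. y (Suc k) = dinasc_trial f N (\<eta> k) (\<gamma> k) (y k) (d k)"
    using that by (rule dinasc_step_size_bounded_below[OF run])
  show ?thesis
  proof (rule decrease_or_contract_tendsto_0[where c = "(1 - \<eta>\<^sub>m)\<^sup>2 / 8 * \<gamma>\<^sub>m" and \<theta> = "(1 + \<eta>\<^sub>m) / 2"])
    show "N (gradient f (y (Suc k))) \<le> N (gradient f (y k)) - (1 - \<eta>\<^sub>m)\<^sup>2 / 8 * \<gamma>\<^sub>m \<or>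
        N (gradient f (y (Suc k))) \<le> (1 + \<eta>\<^sub>m) / 2 * N (gradient f (y k))" for k
      unfolding ySuc by (rule accept_gradient_decrease[OF acc \<eta>(2,3,1) m low])
    show "0 < (1 - \<eta>\<^sub>m)\<^sup>2 / 8 * \<gamma>\<^sub>m" "0 \<le> (1 + \<eta>\<^sub>m) / 2" "(1 + \<eta>\<^sub>m) / 2 < 1"
      using \<eta>(1) \<eta>\<^sub>m m by simp_all
  qed simp
qed

lemma dinasc_error_tendsto_0:
  assumes run: "dinasc f N \<gamma>\<^sub>0 q \<eta>\<^sub>m \<eta> y" and zero: "gradient f y\<^sub>s = 0"
  shows "(\<lambda>k. N (y k - y\<^sub>s)) \<longlonglongrightarrow> 0"
proof (rule tendsto_sandwich[OF _ _ tendsto_const])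
  show "(\<lambda>k. C * N (gradient f (y k))) \<longlonglongrightarrow> 0"
    by (rule tendsto_mult_right_zero[OF dinasc_gradient_tendsto_0[OF run]])
  show "\<forall>\<^sub>F k in sequentially. N (y k - y\<^sub>s) \<le> C * N (gradient f (y k))"
    using gradient_inverse_bound[of _ y\<^sub>s] zero by (intro always_eventually) auto
qed simp

lemma dinasc_tendsto:
  assumes run: "dinasc f N \<gamma>\<^sub>0 q \<eta>\<^sub>m \<eta> y" and zero: "gradient f y\<^sub>s = 0"
  shows "y \<longlonglongrightarrow> y\<^sub>s"
proof -
  obtain a b where a: "0 < a" and "0 < b" and lower: "\<And>x. a * norm x \<le> N x"
    and "\<And>x. N x \<le> b * norm x"
    using is_norm_equivalent_norm[OF is_norm] by blast
  have "(\<lambda>k. norm (y k - y\<^sub>s)) \<longlonglongrightarrow> 0"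
  proof (rule tendsto_sandwich[OF _ _ tendsto_const])
    show "(\<lambda>k. N (y k - y\<^sub>s) / a) \<longlonglongrightarrow> 0"
      by (rule tendsto_divide_zero[OF dinasc_error_tendsto_0[OF run zero]])
    show "\<forall>\<^sub>F k in sequentially. norm (y k - y\<^sub>s) \<le> N (y k - y\<^sub>s) / a"
      using lower a by (intro always_eventually) (auto simp: field_simps)
  qed simp
  then show ?thesis by (simp add: LIM_zero_iff tendsto_norm_zero_iff)
qed

text \<open>Since the step size parameter is bounded below and the gradient tends to 0, the step
  length is eventually 1.\<close>

lemma dinasc_eventually_full_step:
  assumes run: "dinasc f N \<gamma>\<^sub>0 q \<eta>\<^sub>m \<eta> y"
  shows "\<forall>\<^sub>F k in sequentially. \<exists>d. y (Suc k) = y k - d \<and>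
    N (hessian f (y k) *v d - gradient f (y k)) \<le> \<eta> k * N (gradient f (y k))"
proof -
  note \<eta> = dinasc_parameters(4-6)[OF run]
  obtain \<gamma>\<^sub>m \<gamma> d where m: "0 < \<gamma>\<^sub>m" and low: "\<And>k. \<gamma>\<^sub>m \<le> \<gamma> k"
    and d: "\<And>k. N (hessian f (y k) *v d k - gradient f (y k)) \<le> \<eta> k * N (gradient f (y k))"
    and acc: "\<And>k. dinasc_accept f N (\<eta> k) (\<gamma> k) (y k) (d k)"
    and ySuc: "\<And>k. y (Suc k) = dinasc_trial f N (\<eta> k) (\<gamma> k) (y k) (d k)"
    using that by (rule dinasc_step_size_bounded_below[OF run])
  define \<epsilon> where "\<epsilon> = (1 - \<eta>\<^sub>m) / 2\<^sup>2 * \<gamma>\<^sub>m"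
  have "0 < \<epsilon>" using \<eta> m by (simp add: \<epsilon>_def)
  with dinasc_gradient_tendsto_0[OF run]
  have "\<forall>\<^sub>F k in sequentially. N (gradient f (y k)) < \<epsilon>" by (rule order_tendstoD)
  then show ?thesis
  proof eventually_elim
    case (elim k)
    have "\<epsilon> \<le> (1 - \<eta> k) / (1 + \<eta> k)\<^sup>2 * \<gamma> k"
      unfolding \<epsilon>_def using \<eta>(2,3)[of k] \<eta>(1) m low[of k]
      by (intro mult_mono frac_le power_mono) auto
    with elim have "N (gradient f (y k)) \<le> (1 - \<eta> k) / (1 + \<eta> k)\<^sup>2 * \<gamma> k" by simp
    then have "1 \<le> (1 - \<eta> k) / (1 + \<eta> k)\<^sup>2 * \<gamma> k * (1 / N (gradient f (y k)))"
      if "gradient f (y k) \<noteq> 0"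
    proof -
      have "0 < N (gradient f (y k))"
        using that N_nonneg[of "gradient f (y k)"] by (simp add: less_le)
      moreover have "1 \<le> a * (1 / g)" if "g \<le> a" "0 < g" for a g :: real
        using that by simp
      ultimately show ?thesis using \<open>N (gradient f (y k)) \<le> _\<close> by blast
    qed
    then have "dinasc_step f N (\<eta> k) (\<gamma> k) (y k) = 1"
      unfolding dinasc_step_def by (simp add: min_def)
    then show ?case using d[of k] ySuc[of k] by (auto simp: dinasc_trial_def)
  qed
qed

lemma dinasc_error_recursion:
  assumes run: "dinasc f N \<gamma>\<^sub>0 q \<eta>\<^sub>m \<eta> y" and zero: "gradient f y\<^sub>s = 0"
    and B: "0 < B" "\<forall>y. N (y - y\<^sub>s) \<le> 1 \<longrightarrow> N (gradient f y) \<le> B * N (y - y\<^sub>s)"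
  shows "\<forall>\<^sub>F k in sequentially. N (gradient f (y k)) \<le> B * N (y k - y\<^sub>s) \<and>
    N (y (Suc k) - y\<^sub>s) \<le> (C * K * N (y k - y\<^sub>s) + C * B * \<eta> k) * N (y k - y\<^sub>s)"
proof -
  note \<eta> = dinasc_parameters(5)[OF run]
  have "\<forall>\<^sub>F k in sequentially. N (y k - y\<^sub>s) < 1"
    using dinasc_error_tendsto_0[OF run zero] by (rule order_tendstoD) simp
  with dinasc_eventually_full_step[OF run] show ?thesis
  proof eventually_elim
    case (elim k)
    let ?e = "N (y k - y\<^sub>s)"
    obtain d where d: "y (Suc k) = y k - d"
      "N (hessian f (y k) *v d - gradient f (y k)) \<le> \<eta> k * N (gradient f (y k))"
      using elim by blast
    have g: "N (gradient f (y k)) \<le> B * ?e" using elim B(2) by simp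
    have "N (y (Suc k) - y\<^sub>s) \<le> C * (K * ?e\<^sup>2 + \<eta> k * N (gradient f (y k)))"
      unfolding d(1) by (rule full_step_error[OF zero d(2)])
    also have "\<dots> \<le> C * (K * ?e\<^sup>2 + \<eta> k * (B * ?e))"
      using C_pos \<eta>[of k] g by (intro mult_left_mono add_left_mono) auto
    finally show ?case using g by (simp add: power2_eq_square algebra_simps)
  qed
qed

text \<open>The threshold makes the coefficient \<open>C * B * \<eta> k\<close> of the linear term at most a half; the
  remaining coefficient tends to 0 with the error, so any factor above a half works.\<close>

lemma dinasc_linear_rate:
  assumes run: "dinasc f N \<gamma>\<^sub>0 q \<eta>\<^sub>m \<eta> y" and zero: "gradient f y\<^sub>s = 0"
    and B: "0 < B" "\<forall>y. N (y - y\<^sub>s) \<le> 1 \<longrightarrow> N (gradient f y) \<le> B * N (y - y\<^sub>s)"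
    and small: "\<And>k. \<eta> k \<le> 1 / (2 * C * B)"
  shows "linear_rate (\<lambda>k. N (y k - y\<^sub>s))"
proof -
  note e = dinasc_error_tendsto_0[OF run zero]
  have "(\<lambda>k. C * K * N (y k - y\<^sub>s)) \<longlonglongrightarrow> 0" by (rule tendsto_mult_right_zero[OF e])
  then have "\<forall>\<^sub>F k in sequentially. C * K * N (y k - y\<^sub>s) < 1 / 4"
    by (rule order_tendstoD) simp
  with dinasc_error_recursion[OF run zero B]
  have "\<forall>\<^sub>F k in sequentially. N (y (Suc k) - y\<^sub>s) \<le> 3 / 4 * N (y k - y\<^sub>s)"
  proof eventually_elim
    case (elim k)
    have "C * B * \<eta> k \<le> 1 / 2" using small[of k] C_pos B(1) by (simp add: field_simps)
    then have "(C * K * N (y k - y\<^sub>s) + C * B * \<eta> k) * N (y k - y\<^sub>s) \<le> 3 / 4 * N (y k - y\<^sub>s)"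
      using elim by (intro mult_right_mono) auto
    then show ?case using elim by linarith
  qed
  then show ?thesis unfolding linear_rate_def using e
    by (intro conjI exI[of _ "3/4"]) auto
qed

lemma dinasc_superlinear_rate:
  assumes run: "dinasc f N \<gamma>\<^sub>0 q \<eta>\<^sub>m \<eta> y" and zero: "gradient f y\<^sub>s = 0"
    and \<delta>: "0 < \<delta>"
    and forcing: "\<forall>\<^sub>F k in sequentially. \<eta> k \<le> \<eta>\<^sub>c * N (gradient f (y k)) powr \<delta>"
  shows "superlinear_rate (\<lambda>k. N (y k - y\<^sub>s))"
proof -
  note e = dinasc_error_tendsto_0[OF run zero]
  obtain B where B: "0 < B" "\<forall>y. N (y - y\<^sub>s) \<le> 1 \<longrightarrow> N (gradient f y) \<le> B * N (y - y\<^sub>s)"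
    using gradient_local_bound[OF zero] by blast
  define c where "c k = C * K * N (y k - y\<^sub>s) + C * B * (\<eta>\<^sub>c * N (gradient f (y k)) powr \<delta>)" for k
  have "(\<lambda>k. N (gradient f (y k)) powr \<delta>) \<longlonglongrightarrow> 0"
    by (rule tendsto_zero_powrI[OF dinasc_gradient_tendsto_0[OF run] tendsto_const _ \<delta>]) simp
  then have "c \<longlonglongrightarrow> 0"
    unfolding c_def by (intro tendsto_add_zero tendsto_mult_right_zero e)
  moreover have "\<forall>\<^sub>F k in sequentially. N (y (Suc k) - y\<^sub>s) \<le> c k * N (y k - y\<^sub>s)"
    using dinasc_error_recursion[OF run zero B] forcing
  proof eventually_elim
    case (elim k)
    have "C * K * N (y k - y\<^sub>s) + C * B * \<eta> k \<le> c k"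
      unfolding c_def using C_pos B(1) elim by (intro add_left_mono mult_left_mono) auto
    then have "(C * K * N (y k - y\<^sub>s) + C * B * \<eta> k) * N (y k - y\<^sub>s) \<le> c k * N (y k - y\<^sub>s)"
      by (rule mult_right_mono) simp
    then show ?case using elim by linarith
  qed
  ultimately show ?thesis unfolding superlinear_rate_def using e by blast
qed

lemma dinasc_quadratic_rate:
  assumes run: "dinasc f N \<gamma>\<^sub>0 q \<eta>\<^sub>m \<eta> y" and zero: "gradient f y\<^sub>s = 0"
    and \<eta>\<^sub>c: "0 \<le> \<eta>\<^sub>c"
    and forcing: "\<forall>\<^sub>F k in sequentially. \<eta> k \<le> \<eta>\<^sub>c * N (gradient f (y k))"
  shows "quadratic_rate (\<lambda>k. N (y k - y\<^sub>s))"
proof -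
  obtain B where B: "0 < B" "\<forall>y. N (y - y\<^sub>s) \<le> 1 \<longrightarrow> N (gradient f y) \<le> B * N (y - y\<^sub>s)"
    using gradient_local_bound[OF zero] by blast
  define c where "c = C * K + C * B * (\<eta>\<^sub>c * B)"
  have "0 < C * K" "0 \<le> C * B * (\<eta>\<^sub>c * B)" using C_pos K_pos B(1) \<eta>\<^sub>c by auto
  then have "0 < c" unfolding c_def by linarith
  moreover have "\<forall>\<^sub>F k in sequentially. N (y (Suc k) - y\<^sub>s) \<le> c * (N (y k - y\<^sub>s))\<^sup>2"
    using dinasc_error_recursion[OF run zero B] forcing
  proof eventually_elim
    case (elim k)
    let ?e = "N (y k - y\<^sub>s)"
    have "\<eta>\<^sub>c * N (gradient f (y k)) \<le> \<eta>\<^sub>c * (B * ?e)"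
      using elim \<eta>\<^sub>c by (intro mult_left_mono) auto
    then have "\<eta> k \<le> \<eta>\<^sub>c * (B * ?e)" using elim by linarith
    then have "C * K * ?e + C * B * \<eta> k \<le> C * K * ?e + C * B * (\<eta>\<^sub>c * (B * ?e))"
      using C_pos B(1) by (intro add_left_mono mult_left_mono) auto
    then have "(C * K * ?e + C * B * \<eta> k) * ?e \<le> (C * K * ?e + C * B * (\<eta>\<^sub>c * (B * ?e))) * ?e"
      by (rule mult_right_mono) simp
    also have "\<dots> = c * ?e\<^sup>2" by (simp add: c_def power2_eq_square algebra_simps)
    finally show ?case using elim by linarith
  qed
  ultimately show ?thesis
    unfolding quadratic_rate_def using dinasc_error_tendsto_0[OF run zero] by blast
qed

end

lemma A3_newton_bounds:
  fixes f :: "real^'n \<Rightarrow> real"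
  assumes A3: "assumption_A3 f \<mu> M L" and N: "is_norm N"
  obtains C K where "newton_bounds f N C K"
proof -
  obtain a b where a: "0 < a" and b: "0 < b"
    and lower: "\<And>x. a * norm x \<le> N x" and upper: "\<And>x. N x \<le> b * norm x"
    using is_norm_equivalent_norm[OF N] by blast
  have \<mu>: "0 < \<mu>" and L: "0 < L" using A3 unfolding assumption_A3_def by auto
  define C where "C = b / (\<mu> * a)"
  define c where "c = sqrt (real CARD('n)) * L"
  define K where "K = b * c / a\<^sup>2"
  have c: "0 < c" using L by (simp add: c_def)
  have C_le: "N v \<le> C * N w" if "\<mu> * norm v \<le> norm w" for v w :: "real^'n"
  proof -
    have "norm v \<le> norm w / \<mu>" using that \<mu> by (simp add: field_simps)
    moreover have "norm w \<le> N w / a" using lower[of w] a by (simp add: field_simps)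
    ultimately have "norm v \<le> N w / a / \<mu>" using \<mu> by (meson divide_right_mono less_imp_le order_trans)
    then have "b * norm v \<le> b * (N w / a / \<mu>)" using b by (intro mult_left_mono) auto
    then show ?thesis using upper[of v] by (simp add: C_def mult_ac)
  qed
  have "newton_bounds f N C K"
  proof
    show "0 < C" "0 < K" using a b c \<mu> by (simp_all add: C_def K_def)
    show "N h \<le> C * N (hessian f y *v h)" for h y
      by (rule C_le[OF hessian_norm_lower_bound[OF A3]])
    show "N (y - z) \<le> C * N (gradient f y - gradient f z)" for y z
      by (rule C_le[OF gradient_norm_lower_bound[OF A3]])
    show "N (gradient f (y + h) - gradient f y - hessian f y *v h) \<le> K * (N h)\<^sup>2" for y h
    proof -
      have "N (gradient f (y + h) - gradient f y - hessian f y *v h) \<le> b * (c * (norm h)\<^sup>2)"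
        using upper[of "gradient f (y + h) - gradient f y - hessian f y *v h"]
          mult_left_mono[OF gradient_linearization_error[OF A3, of y h], of b] b
        unfolding c_def by linarith
      also have "\<dots> \<le> b * (c * (N h / a)\<^sup>2)"
        using a b c lower[of h] by (intro mult_left_mono power_mono) (auto simp: field_simps)
      finally show ?thesis by (simp add: K_def power_divide)
    qed
  qed (rule N)
  then show ?thesis by (rule that)
qed

theorem theorem5p1:
  fixes f :: "real^'n \<Rightarrow> real" and N :: "real^'n \<Rightarrow> real" and \<mu> M L :: real
  assumes "assumption_A3 f \<mu> M L" and "is_norm N"
  shows "\<exists>y\<^sub>s. unique_minimizer f y\<^sub>s \<and>
    (\<forall>\<gamma>\<^sub>0 q \<eta>\<^sub>m\<^sub>a\<^sub>x \<eta> y. dinasc f N \<gamma>\<^sub>0 q \<eta>\<^sub>m\<^sub>a\<^sub>x \<eta> y \<longrightarrow> y \<longlonglongrightarrow> y\<^sub>s) \<and>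
    (\<exists>\<tau>>0. \<forall>\<gamma>\<^sub>0 q \<eta>\<^sub>m\<^sub>a\<^sub>x \<eta> y \<eta>\<^sub>b.
        dinasc f N \<gamma>\<^sub>0 q \<eta>\<^sub>m\<^sub>a\<^sub>x \<eta> y \<and> decseq \<eta> \<and> 0 < \<eta>\<^sub>b \<and> \<eta>\<^sub>b < \<tau> \<and> (\<forall>k. \<eta> k \<le> \<eta>\<^sub>b)
        \<longrightarrow> linear_rate (\<lambda>k. N (y k - y\<^sub>s))) \<and>
    (\<forall>\<gamma>\<^sub>0 q \<eta>\<^sub>m\<^sub>a\<^sub>x \<eta> y \<eta>\<^sub>c \<delta>.
        dinasc f N \<gamma>\<^sub>0 q \<eta>\<^sub>m\<^sub>a\<^sub>x \<eta> y \<and> 0 \<le> \<eta>\<^sub>c \<and>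
        (\<forall>\<^sub>F k in sequentially. \<eta> k \<le> \<eta>\<^sub>c * N (gradient f (y k)) powr \<delta>)
        \<longrightarrow> (0 < \<delta> \<and> \<delta> < 1 \<longrightarrow> superlinear_rate (\<lambda>k. N (y k - y\<^sub>s))) \<and>
            (\<delta> = 1 \<longrightarrow> quadratic_rate (\<lambda>k. N (y k - y\<^sub>s))))"
proof -
  have C2: "\<And>x. f differentiable (at x)" and sc: "strongly_convex f"
    using assms(1) unfolding assumption_A3_def twice_continuously_differentiable_def by auto
  have "continuous_on UNIV f"
    using C2 by (simp add: continuous_on_eq_continuous_at differentiable_imp_continuous_within)
  then obtain y\<^sub>s where min: "unique_minimizer f y\<^sub>s"
    using strongly_convex_unique_minimizer[OF sc] by blast
  have zero: "gradient f y\<^sub>s = 0" by (rule gradient_minimizer_eq_0[OF C2 min])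
  obtain C K where "newton_bounds f N C K" using A3_newton_bounds[OF assms] by blast
  then interpret newton_bounds f N C K .
  obtain B where B: "0 < B" "\<forall>y. N (y - y\<^sub>s) \<le> 1 \<longrightarrow> N (gradient f y) \<le> B * N (y - y\<^sub>s)"
    using gradient_local_bound[OF zero] by blast
  have threshold: "0 < 1 / (2 * C * B)" using C_pos B(1) by simp
  show ?thesis
  proof (intro exI[of _ y\<^sub>s] conjI exI[of _ "1 / (2 * C * B)"] allI impI min threshold; (elim conjE)?)
    show "y \<longlonglongrightarrow> y\<^sub>s" if "dinasc f N \<gamma>\<^sub>0 q \<eta>\<^sub>m \<eta> y" for \<gamma>\<^sub>0 q \<eta>\<^sub>m \<eta> y
      by (rule dinasc_tendsto[OF that zero])
    show "linear_rate (\<lambda>k. N (y k - y\<^sub>s))"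
      if "dinasc f N \<gamma>\<^sub>0 q \<eta>\<^sub>m \<eta> y" "\<eta>\<^sub>b < 1 / (2 * C * B)" "\<forall>k. \<eta> k \<le> \<eta>\<^sub>b"
      for \<gamma>\<^sub>0 q \<eta>\<^sub>m \<eta> y \<eta>\<^sub>b
    proof (rule dinasc_linear_rate[OF that(1) zero B])
      show "\<eta> k \<le> 1 / (2 * C * B)" for k
        by (rule order_trans[OF spec[OF that(3)] less_imp_le[OF that(2)]])
    qed
    show "superlinear_rate (\<lambda>k. N (y k - y\<^sub>s))"
      if "dinasc f N \<gamma>\<^sub>0 q \<eta>\<^sub>m \<eta> y" "0 < \<delta>"
        "\<forall>\<^sub>F k in sequentially. \<eta> k \<le> \<eta>\<^sub>c * N (gradient f (y k)) powr \<delta>"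
      for \<gamma>\<^sub>0 q \<eta>\<^sub>m \<eta> y \<eta>\<^sub>c \<delta>
      by (rule dinasc_superlinear_rate[OF that(1) zero that(2,3)])
    show "quadratic_rate (\<lambda>k. N (y k - y\<^sub>s))"
      if "dinasc f N \<gamma>\<^sub>0 q \<eta>\<^sub>m \<eta> y" "0 \<le> \<eta>\<^sub>c" "\<delta> = 1"
        "\<forall>\<^sub>F k in sequentially. \<eta> k \<le> \<eta>\<^sub>c * N (gradient f (y k)) powr \<delta>"
      for \<gamma>\<^sub>0 q \<eta>\<^sub>m \<eta> y \<eta>\<^sub>c \<delta>
      using that(3,4) by (intro dinasc_quadratic_rate[OF that(1) zero that(2)]) simp
  qed
qed

end
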